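(* Let $(\mathfrak{S},T)$ be an oriented Hall triple system, let $S=\mathfrak{S}\cup\{e\}$ be its associated Steiner loop, and let $L$ be the associated oriented Hall loop of exponent $4$, i.e. $L=S\times\{1,-1\}$ with multiplication $(x,\xi)\cdot(y,\eta)=(xy,\,f(x,y)\,\xi\eta)$, where $f(e,x)=f(x,e)=1$ for all $x\in S$, $f(x,x)=-1$ for all $x\in S\setminus\{e\}$, and for distinct $x,y\in\mathfrak{S}$, $f(x,y)$ is the orientation function of $(\mathfrak{S},T)$. Then $L$ satisfies the Moufang's theorem: for all $\mathrm{x},\mathrm{y},\mathrm{z}\in L$ with $\mathrm{x}(\mathrm{y}\mathrm{z})=(\mathrm{x}\mathrm{y})\mathrm{z}$, the subloop of $L$ generated by $\mathrm{x},\mathrm{y},\mathrm{z}$ is a group.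
   Context: A Steiner triple system (STS) $\mathfrak{S}$ is a set of points together with a family of 3-element subsets (blocks) such that any two distinct points lie in exactly one block. A Hall triple system (HTS) is an STS in which any three non-collinear points (points not lying in one block) generate a subsystem isomorphic to the affine plane over $GF(3)$. The Steiner loop $S=\mathfrak{S}\cup\{e\}$ of an STS has multiplication: for distinct $x,y\in\mathfrak{S}$, $xy$ is the third point of the block containing $x,y$; $xx=e$; $ex=xe=x$. An oriented STS $(\mathfrak{S},T)$ is an STS in which each block is given a cyclic order; its orientation function is defined for distinct $x,y\in\mathfrak{S}$ by $f(x,y)=1$ if $(x,y,xy)$ is in the given cyclic order of its block and $f(x,y)=-1$ otherwise. The group $Z_2$ is written multiplicatively as $\{1,-1\}$. An oriented Hall loop is the oriented Steiner loop (extension of $Z_2$ by the Steiner loop with factor system $f$ as described) associated with an oriented HTS; it has exponent $4$ when $f(x,x)=-1$ for all $x\neq e$, and exponent $2$ when $f(x,x)=1$ for all $x\neq e$. *)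

theory Defs
  imports "HOL-Algebra.Group" "HOL-Library.Numeral_Type" "HOL-Library.Product_Plus"
begin

subsection \<open>Steiner and Hall triple systems\<close>

locale steiner_triple_system =
  fixes P :: "'a set" and B :: "'a set set"
  assumes block_subset: "b \<in> B \<Longrightarrow> b \<subseteq> P"
    and card_block: "b \<in> B \<Longrightarrow> card b = 3"
    and unique_block: "\<lbrakk>x \<in> P; y \<in> P; x \<noteq> y\<rbrakk> \<Longrightarrow> \<exists>!b. b \<in> B \<and> x \<in> b \<and> y \<in> b"

definition collinear_in :: "'a set set \<Rightarrow> 'a set \<Rightarrow> bool" where
  "collinear_in B X \<longleftrightarrow> (\<exists>b\<in>B. X \<subseteq> b)"

definition subsystem :: "'a set \<Rightarrow> 'a set set \<Rightarrow> 'a set \<Rightarrow> bool" where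
  "subsystem P B Q \<longleftrightarrow>
     Q \<subseteq> P \<and> (\<forall>x\<in>Q. \<forall>y\<in>Q. x \<noteq> y \<longrightarrow> (\<forall>b\<in>B. x \<in> b \<and> y \<in> b \<longrightarrow> b \<subseteq> Q))"

definition subsystem_blocks :: "'a set set \<Rightarrow> 'a set \<Rightarrow> 'a set set" where
  "subsystem_blocks B Q = {b \<in> B. b \<subseteq> Q}"

definition generated_subsystem :: "'a set \<Rightarrow> 'a set set \<Rightarrow> 'a set \<Rightarrow> 'a set" where
  "generated_subsystem P B X = \<Inter>{Q. subsystem P B Q \<and> X \<subseteq> Q}"

definition sts_isomorphic ::
  "'a set \<Rightarrow> 'a set set \<Rightarrow> 'b set \<Rightarrow> 'b set set \<Rightarrow> bool" where
  "sts_isomorphic P B P' B' \<longleftrightarrow> (\<exists>\<phi>. bij_betw \<phi> P P' \<and> (`) \<phi> ` B = B')"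

text \<open>The numeral type \<^typ>\<open>3\<close> carries arithmetic modulo 3 and so serves as \<open>GF(3)\<close>.
  The blocks of the affine plane are its lines.\<close>

definition affine_plane_lines :: "(3 \<times> 3) set set" where
  "affine_plane_lines = {range (\<lambda>t. p + (t * u, t * v)) | p u v. (u, v) \<noteq> (0, 0)}"

locale hall_triple_system = steiner_triple_system +
  assumes plane: "\<lbrakk>x \<in> P; y \<in> P; z \<in> P; distinct [x, y, z]; \<not> collinear_in B {x, y, z}\<rbrakk> \<Longrightarrow>
     (let Q = generated_subsystem P B {x, y, z}
      in sts_isomorphic Q (subsystem_blocks B Q) UNIV affine_plane_lines)"

text \<open>An orientation is given by the set \<open>T\<close> of all triples \<open>(x, y, z)\<close> that are in the cyclic
  order chosen on the block \<open>{x, y, z}\<close>; each block thus contributes the three rotations of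
  one of its two cyclic orders.\<close>

locale oriented_hall_triple_system = hall_triple_system +
  fixes T :: "('a \<times> 'a \<times> 'a) set"
  assumes orient_block: "(x, y, z) \<in> T \<Longrightarrow> {x, y, z} \<in> B"
    and orient_rotate: "(x, y, z) \<in> T \<Longrightarrow> (y, z, x) \<in> T"
    and orient_choice: "{x, y, z} \<in> B \<Longrightarrow> (x, y, z) \<in> T \<longleftrightarrow> (x, z, y) \<notin> T"


subsection \<open>Loops\<close>

definition is_loop :: "('a, 'm) monoid_scheme \<Rightarrow> bool" where
  "is_loop G \<longleftrightarrow>
     \<one>\<^bsub>G\<^esub> \<in> carrier G \<and>
     (\<forall>x\<in>carrier G. \<forall>y\<in>carrier G. x \<otimes>\<^bsub>G\<^esub> y \<in> carrier G) \<and>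
     (\<forall>x\<in>carrier G. \<one>\<^bsub>G\<^esub> \<otimes>\<^bsub>G\<^esub> x = x \<and> x \<otimes>\<^bsub>G\<^esub> \<one>\<^bsub>G\<^esub> = x) \<and>
     (\<forall>a\<in>carrier G. \<forall>b\<in>carrier G. \<exists>!x. x \<in> carrier G \<and> a \<otimes>\<^bsub>G\<^esub> x = b) \<and>
     (\<forall>a\<in>carrier G. \<forall>b\<in>carrier G. \<exists>!y. y \<in> carrier G \<and> y \<otimes>\<^bsub>G\<^esub> a = b)"

definition subloop :: "'a set \<Rightarrow> ('a, 'm) monoid_scheme \<Rightarrow> bool" where
  "subloop H G \<longleftrightarrow> H \<subseteq> carrier G \<and> is_loop (G\<lparr>carrier := H\<rparr>)"

definition generated_subloop :: "('a, 'm) monoid_scheme \<Rightarrow> 'a set \<Rightarrow> 'a set" where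
  "generated_subloop G X = \<Inter>{H. subloop H G \<and> X \<subseteq> H}"

definition satisfies_moufang_theorem :: "('a, 'm) monoid_scheme \<Rightarrow> bool" where
  "satisfies_moufang_theorem G \<longleftrightarrow>
     (\<forall>x\<in>carrier G. \<forall>y\<in>carrier G. \<forall>z\<in>carrier G.
        x \<otimes>\<^bsub>G\<^esub> (y \<otimes>\<^bsub>G\<^esub> z) = (x \<otimes>\<^bsub>G\<^esub> y) \<otimes>\<^bsub>G\<^esub> z \<longrightarrow>
        group (G\<lparr>carrier := generated_subloop G {x, y, z}\<rparr>))"


subsection \<open>Steiner loops and oriented Hall loops\<close>

definition third_point :: "'a set set \<Rightarrow> 'a \<Rightarrow> 'a \<Rightarrow> 'a" where
  "third_point B x y = (THE z. {x, y, z} \<in> B)"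

text \<open>The adjoined identity \<open>e\<close> is \<^const>\<open>None\<close>, and a point \<open>x\<close> becomes \<^term>\<open>Some x\<close>.\<close>

fun steiner_mult :: "'a set set \<Rightarrow> 'a option \<Rightarrow> 'a option \<Rightarrow> 'a option" where
  "steiner_mult B None y = y"
| "steiner_mult B x None = x"
| "steiner_mult B (Some x) (Some y) = (if x = y then None else Some (third_point B x y))"

definition steiner_loop :: "'a set \<Rightarrow> 'a set set \<Rightarrow> 'a option monoid" where
  "steiner_loop P B =
     \<lparr>carrier = insert None (Some ` P), monoid.mult = steiner_mult B, one = None\<rparr>"

definition orientation_function ::
  "'a set set \<Rightarrow> ('a \<times> 'a \<times> 'a) set \<Rightarrow> 'a \<Rightarrow> 'a \<Rightarrow> int" where
  "orientation_function B T x y = (if (x, y, third_point B x y) \<in> T then 1 else -1)"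

text \<open>The value \<open>-1\<close> on the diagonal is what gives the loop exponent 4.\<close>

fun factor_system4 ::
  "'a set set \<Rightarrow> ('a \<times> 'a \<times> 'a) set \<Rightarrow> 'a option \<Rightarrow> 'a option \<Rightarrow> int" where
  "factor_system4 B T None y = 1"
| "factor_system4 B T x None = 1"
| "factor_system4 B T (Some x) (Some y) = (if x = y then -1 else orientation_function B T x y)"

definition oriented_hall_loop4 ::
  "'a set \<Rightarrow> 'a set set \<Rightarrow> ('a \<times> 'a \<times> 'a) set \<Rightarrow> ('a option \<times> int) monoid" where
  "oriented_hall_loop4 P B T =
     \<lparr>carrier = carrier (steiner_loop P B) \<times> {1, -1},
      monoid.mult = (\<lambda>(x, \<xi>) (y, \<eta>). (x \<otimes>\<^bsub>steiner_loop P B\<^esub> y, factor_system4 B T x y * \<xi> * \<eta>)),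
      one = (None, 1)\<rparr>"

end

theory Submission
  imports Defs
begin

text \<open>If the projections \<open>a, b, c\<close> of three elements of \<open>L\<close> to the Steiner loop are non-collinear
  points, they lie in an affine plane over \<open>GF(3)\<close>, where the product of distinct points is
  \<open>xy = -x - y\<close>. Hence \<open>a(bc) = -a + b + c\<close> and \<open>(ab)c = a + b - c\<close>, and these agree only if
  \<open>a = c\<close>. So an associating triple lies over \<open>{e}\<close> together with at most one point or one block.
  The part of \<open>L\<close> over such a set is a group: of order at most 4, or the quaternion group. The generated
  subloop is closed under \<open>x \<mapsto> x(xx)\<close>, which is inversion, so it is a subgroup of it.\<close>

section \<open>Lines of the affine plane over the field with three elements\<close>

lemma mod3_cases:
  fixes t :: 3
  obtains "t = 0" | "t = 1" | "t = 2"
proof (cases t rule: bit1_cases)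
  case (of_int z)
  then have "z = 0 \<or> z = 1 \<or> z = 2" by auto
  then show ?thesis using of_int that by auto
qed

lemma mod3_triple: "t + t + t = (0 :: 3)"
  by (cases t rule: mod3_cases) simp_all

text \<open>Three distinct elements exhaust the field, and 0 + 1 + 2 = 3 = 0.\<close>

lemma mod3_distinct_sum:
  fixes r s t :: 3
  assumes "r \<noteq> s" "r \<noteq> t" "s \<noteq> t"
  shows "r + s + t = 0"
  using assms
  by (cases r rule: mod3_cases; cases s rule: mod3_cases; cases t rule: mod3_cases) simp_all

text \<open>With direction d the points are p + r d, p + s d and p + t d for distinct r, s, t, so
  both 3p and (r + s + t) d vanish. This is the rule xy = -x - y in additive form.\<close>

lemma affine_line_sum_eq_0:
  assumes l: "{x, y, z} \<in> affine_plane_lines" and d: "x \<noteq> y" "x \<noteq> z" "y \<noteq> z"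
  shows "x + y + z = 0"
proof -
  obtain p u v where "{x, y, z} = range (\<lambda>t. p + (t * u, t * v))"
    using l unfolding affine_plane_lines_def by auto
  then obtain r s t where
    x: "x = p + (r * u, r * v)" and y: "y = p + (s * u, s * v)" and z: "z = p + (t * u, t * v)"
    by (smt (verit) imageE insertCI)
  have "r + s + t = 0"
    using d by (intro mod3_distinct_sum) (auto simp: x y z)
  moreover have "x + y + z = (fst p + fst p + fst p + (r + s + t) * u,
      snd p + snd p + snd p + (r + s + t) * v)"
    by (cases p) (simp add: x y z algebra_simps)
  ultimately show ?thesis by (simp only: mod3_triple) (simp add: zero_prod_def)
qed

text \<open>Here \<open>u\<close> stands for bc, \<open>v\<close> for ab and \<open>w\<close> for
  the common value of a(bc) and (ab)c. Cancelling \<open>w\<close> gives a + u = v + c, hence 2a =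
  2c, and 2 = -1 can be cancelled.\<close>

lemma affine_plane_assoc_imp_eq:
  fixes a b c :: "3 \<times> 3"
  assumes "b + c + u = 0" "a + u + w = 0" "a + b + v = 0" "v + c + w = 0"
  shows "a = c"
proof -
  have neg: "t + t = - t" for t :: "3 \<times> 3"
    using mod3_triple[of "fst t"] mod3_triple[of "snd t"]
    by (cases t) (auto simp: eq_neg_iff_add_eq_0)
  have u: "u = - (b + c)" and v: "v = - (a + b)"
    using assms(1,3) by (metis add.commute eq_neg_iff_add_eq_0)+
  have "a + u = v + c"
    using assms(2,4) by (metis add_right_cancel)
  then have "a + a = c + c" by (simp add: u v algebra_simps)
  then show ?thesis by (simp add: neg)
qed

section \<open>The third point of a block\<close>

context steiner_triple_system
begin

lemma block_distinct:
  assumes "{x, y, z} \<in> B"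
  shows "x \<noteq> y" "x \<noteq> z" "y \<noteq> z"
  using card_block[OF assms] by (auto simp: card_insert_if split: if_splits)

lemma third_point_eq:
  assumes b: "{x, y, z} \<in> B"
  shows "third_point B x y = z"
  unfolding third_point_def
proof (rule the_equality)
  fix z' assume b': "{x, y, z'} \<in> B"
  have "x \<in> P" "y \<in> P" using block_subset[OF b] by auto
  then have "{x, y, z} = {x, y, z'}"
    using unique_block[OF _ _ block_distinct(1)[OF b]] b b' by blast
  then show "z' = z" using block_distinct[OF b] block_distinct[OF b'] by auto
qed (rule b)

lemma third_point_block:
  assumes "x \<in> P" "y \<in> P" "x \<noteq> y"
  shows "{x, y, third_point B x y} \<in> B"
proof -
  obtain b where b: "b \<in> B" "x \<in> b" "y \<in> b"
    using unique_block[OF assms] by blast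
  have fin: "finite b" using card_block[OF b(1)] by (simp add: card_ge_0_finite)
  have "card (b - {x, y}) = 1"
    using card_block[OF b(1)] b assms(3) fin by (simp add: card_Diff_subset)
  then obtain z where "b - {x, y} = {z}" by (auto simp: card_1_singleton_iff)
  then have "b = {x, y, z}" using b by auto
  then show ?thesis using b(1) third_point_eq by metis
qed

end

text \<open>An isomorphism \<open>\<phi>\<close> from the generated plane to the affine plane turns
  every block into a relation with sum 0. Associativity would then force
  \<open>\<phi> a = \<phi> c\<close>, against injectivity.\<close>

lemma (in hall_triple_system) steiner_mult_not_assoc:
  assumes P: "a \<in> P" "b \<in> P" "c \<in> P" and d: "distinct [a, b, c]"
    and nc: "\<not> collinear_in B {a, b, c}"
  shows "steiner_mult B (Some a) (steiner_mult B (Some b) (Some c)) \<noteq>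
    steiner_mult B (steiner_mult B (Some a) (Some b)) (Some c)"
proof
  assume eq: "steiner_mult B (Some a) (steiner_mult B (Some b) (Some c)) =
    steiner_mult B (steiner_mult B (Some a) (Some b)) (Some c)"
  define Q where "Q = generated_subsystem P B {a, b, c}"
  obtain \<phi> where inj: "inj_on \<phi> Q" and lines: "(`) \<phi> ` subsystem_blocks B Q = affine_plane_lines"
    using plane[OF P d nc] that
    unfolding Let_def sts_isomorphic_def Q_def[symmetric] bij_betw_def by (elim exE conjE)
  have Q: "a \<in> Q" "b \<in> Q" "c \<in> Q" by (auto simp: Q_def generated_subsystem_def)
  \<comment> \<open>A block with two points in \<open>Q\<close> has its third there too, since this
    holds in every subsystem through a, b, c; so \<open>\<phi>\<close> sends the block to a
    line.\<close>
  have closed: "z \<in> Q" if "x \<in> Q" "y \<in> Q" "{x, y, z} \<in> B" for x y z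
    unfolding Q_def generated_subsystem_def
  proof (rule InterI, clarify)
    fix R assume R: "subsystem P B R" "{a, b, c} \<subseteq> R"
    then have "x \<in> R" "y \<in> R" using that by (auto simp: Q_def generated_subsystem_def)
    then have "{x, y, z} \<subseteq> R"
      using R(1) that(3) block_distinct(1)[OF that(3)] unfolding subsystem_def by blast
    then show "z \<in> R" by simp
  qed
  have sum: "\<phi> x + \<phi> y + \<phi> z = 0" if "x \<in> Q" "y \<in> Q" "{x, y, z} \<in> B" for x y z
  proof (rule affine_line_sum_eq_0)
    have z: "z \<in> Q" using closed that by blast
    then have "{x, y, z} \<in> subsystem_blocks B Q"
      using that by (simp add: subsystem_blocks_def)
    then have "\<phi> ` {x, y, z} \<in> affine_plane_lines" using lines by blast
    then show "{\<phi> x, \<phi> y, \<phi> z} \<in> affine_plane_lines" by simp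
    show "\<phi> x \<noteq> \<phi> y" "\<phi> x \<noteq> \<phi> z" "\<phi> y \<noteq> \<phi> z"
      using block_distinct[OF that(3)] that z inj by (auto dest: inj_onD)
  qed
  define u where "u = third_point B b c"
  define v where "v = third_point B a b"
  have bu: "{b, c, u} \<in> B" and bv: "{a, b, v} \<in> B"
    using third_point_block[of b c] third_point_block[of a b] P d by (simp_all add: u_def v_def)
  have uP: "u \<in> P" and vP: "v \<in> P" using block_subset[OF bu] block_subset[OF bv] by auto
  \<comment> \<open>If u = a or v = c, then {a, b, c} would itself be a block. So both outer
    products are of distinct points and are third points, not the identity.\<close>
  have "{a, b, c} \<notin> B" using nc unfolding collinear_in_def by blast
  moreover have "{b, c, a} = {a, b, c}" by blast
  ultimately have au: "a \<noteq> u" and vc: "v \<noteq> c" using bu bv by metis+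
  define w where "w = third_point B a u"
  have w: "w = third_point B v c"
    using eq d au vc unfolding u_def v_def w_def by simp
  have bw: "{a, u, w} \<in> B" "{v, c, w} \<in> B"
    using third_point_block[OF P(1) uP au] third_point_block[OF vP P(3) vc]
    by (simp_all add: w_def[symmetric] w[symmetric])
  have uQ: "u \<in> Q" and vQ: "v \<in> Q" using closed Q bu bv by blast+
  have "\<phi> a = \<phi> c"
    by (rule affine_plane_assoc_imp_eq[OF sum[OF Q(2,3) bu] sum[OF Q(1) uQ bw(1)]
          sum[OF Q(1,2) bv] sum[OF vQ Q(3) bw(2)]])
  then show False using inj Q d by (auto dest: inj_onD)
qed

section \<open>Subloops and groups\<close>

lemma group_imp_is_loop:
  assumes "group G"
  shows "is_loop G"
proof -
  interpret group G by fact
  have "\<exists>!x. x \<in> carrier G \<and> a \<otimes>\<^bsub>G\<^esub> x = b" "\<exists>!y. y \<in> carrier G \<and> y \<otimes>\<^bsub>G\<^esub> a = b"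
    if "a \<in> carrier G" "b \<in> carrier G" for a b
    using that inv_solve_left[of _ a b] inv_solve_right[of _ b a]
    by (metis inv_closed m_closed inv_solve_left', metis inv_closed m_closed inv_solve_right')
  then show ?thesis unfolding is_loop_def by auto
qed

text \<open>\<open>H\<close> is one of the subloops being intersected, so associativity is inherited
  from it. Products and \<open>\<one>\<close> survive intersection, and \<open>inv\<close> expresses
  inverses as products.\<close>

lemma group_generated_subloop:
  assumes H: "group (G\<lparr>carrier := H\<rparr>)" "H \<subseteq> carrier G" "X \<subseteq> H"
    and inv: "\<And>x. x \<in> H \<Longrightarrow> (x \<otimes>\<^bsub>G\<^esub> (x \<otimes>\<^bsub>G\<^esub> x)) \<otimes>\<^bsub>G\<^esub> x = \<one>\<^bsub>G\<^esub>"
  shows "group (G\<lparr>carrier := generated_subloop G X\<rparr>)"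
proof -
  let ?K = "generated_subloop G X"
  have "subloop H G" using H group_imp_is_loop by (auto simp: subloop_def)
  then have sub: "?K \<subseteq> H" using H by (auto simp: generated_subloop_def)
  have mult: "x \<otimes>\<^bsub>G\<^esub> y \<in> ?K" if "x \<in> ?K" "y \<in> ?K" for x y
    using that by (auto simp: generated_subloop_def subloop_def is_loop_def)
  have one: "\<one>\<^bsub>G\<^esub> \<in> ?K"
    by (auto simp: generated_subloop_def subloop_def is_loop_def)
  interpret H: group "G\<lparr>carrier := H\<rparr>" by fact
  show ?thesis
  proof (rule groupI)
    fix x y z
    assume "x \<in> carrier (G\<lparr>carrier := ?K\<rparr>)" "y \<in> carrier (G\<lparr>carrier := ?K\<rparr>)"
      "z \<in> carrier (G\<lparr>carrier := ?K\<rparr>)"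
    then show "x \<otimes>\<^bsub>G\<lparr>carrier := ?K\<rparr>\<^esub> y \<otimes>\<^bsub>G\<lparr>carrier := ?K\<rparr>\<^esub> z =
        x \<otimes>\<^bsub>G\<lparr>carrier := ?K\<rparr>\<^esub> (y \<otimes>\<^bsub>G\<lparr>carrier := ?K\<rparr>\<^esub> z)"
      using sub H.m_assoc[of x y z] by auto
  next
    fix x assume x: "x \<in> carrier (G\<lparr>carrier := ?K\<rparr>)"
    then show "\<one>\<^bsub>G\<lparr>carrier := ?K\<rparr>\<^esub> \<otimes>\<^bsub>G\<lparr>carrier := ?K\<rparr>\<^esub> x = x"
      using sub H.l_one[of x] by auto
    show "\<exists>y\<in>carrier (G\<lparr>carrier := ?K\<rparr>). y \<otimes>\<^bsub>G\<lparr>carrier := ?K\<rparr>\<^esub> x = \<one>\<^bsub>G\<lparr>carrier := ?K\<rparr>\<^esub>"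
      using x sub mult inv by (intro bexI[of _ "x \<otimes>\<^bsub>G\<^esub> (x \<otimes>\<^bsub>G\<^esub> x)"]) auto
  qed (use mult one in auto)
qed

section \<open>The part of the oriented Hall loop over a point or a block\<close>

context oriented_hall_triple_system
begin

abbreviation L where "L \<equiv> oriented_hall_loop4 P B T"

text \<open>For Q inside P, the preimage in L of Q with e adjoined, under the projection to the
  Steiner loop.\<close>

abbreviation over :: "'a set \<Rightarrow> ('a option \<times> int) set" where
  "over Q \<equiv> insert None (Some ` Q) \<times> {1, -1}"

lemma L_simps [simp]:
  "carrier L = over P"
  "(x, \<xi>) \<otimes>\<^bsub>L\<^esub> (y, \<eta>) = (steiner_mult B x y, factor_system4 B T x y * \<xi> * \<eta>)"
  "\<one>\<^bsub>L\<^esub> = (None, 1)"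
  by (simp_all add: oriented_hall_loop4_def steiner_loop_def)

text \<open>Over a point, xx is (e, -1), so x(xx) is x with its sign flipped, and one more factor x
  gives sign (-1)(-1) = 1. Over e only a fourth power of a sign remains.\<close>

lemma L_cube_inverse:
  assumes "x \<in> over Q"
  shows "(x \<otimes>\<^bsub>L\<^esub> (x \<otimes>\<^bsub>L\<^esub> x)) \<otimes>\<^bsub>L\<^esub> x = \<one>\<^bsub>L\<^esub>"
  using assms by auto

text \<open>Inverses are supplied by the cube, so only closure and associativity have to be
  checked.\<close>

lemma group_over:
  assumes closed: "\<And>x y. x \<in> over Q \<Longrightarrow> y \<in> over Q \<Longrightarrow> x \<otimes>\<^bsub>L\<^esub> y \<in> over Q"
    and assoc: "\<And>x y z. x \<in> over Q \<Longrightarrow> y \<in> over Q \<Longrightarrow> z \<in> over Q \<Longrightarrow>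
      (x \<otimes>\<^bsub>L\<^esub> y) \<otimes>\<^bsub>L\<^esub> z = x \<otimes>\<^bsub>L\<^esub> (y \<otimes>\<^bsub>L\<^esub> z)"
  shows "group (L\<lparr>carrier := over Q\<rparr>)"
proof (rule groupI)
  fix x assume x: "x \<in> carrier (L\<lparr>carrier := over Q\<rparr>)"
  then show "\<one>\<^bsub>L\<lparr>carrier := over Q\<rparr>\<^esub> \<otimes>\<^bsub>L\<lparr>carrier := over Q\<rparr>\<^esub> x = x"
    by (cases x) simp
  have x': "x \<in> over Q" using x by simp
  show "\<exists>y\<in>carrier (L\<lparr>carrier := over Q\<rparr>).
      y \<otimes>\<^bsub>L\<lparr>carrier := over Q\<rparr>\<^esub> x = \<one>\<^bsub>L\<lparr>carrier := over Q\<rparr>\<^esub>"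
    using L_cube_inverse[OF x'] closed[OF x' closed[OF x' x']]
    by (intro bexI[of _ "x \<otimes>\<^bsub>L\<^esub> (x \<otimes>\<^bsub>L\<^esub> x)"]) simp_all
next
  fix x y z
  assume "x \<in> carrier (L\<lparr>carrier := over Q\<rparr>)" "y \<in> carrier (L\<lparr>carrier := over Q\<rparr>)"
    "z \<in> carrier (L\<lparr>carrier := over Q\<rparr>)"
  then show "x \<otimes>\<^bsub>L\<lparr>carrier := over Q\<rparr>\<^esub> y \<otimes>\<^bsub>L\<lparr>carrier := over Q\<rparr>\<^esub> z =
      x \<otimes>\<^bsub>L\<lparr>carrier := over Q\<rparr>\<^esub> (y \<otimes>\<^bsub>L\<lparr>carrier := over Q\<rparr>\<^esub> z)"
    using assoc[of x y z] by simp
next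
  fix x y
  assume "x \<in> carrier (L\<lparr>carrier := over Q\<rparr>)" "y \<in> carrier (L\<lparr>carrier := over Q\<rparr>)"
  then show "x \<otimes>\<^bsub>L\<lparr>carrier := over Q\<rparr>\<^esub> y \<in> carrier (L\<lparr>carrier := over Q\<rparr>)"
    using closed[of x y] by simp
qed simp

text \<open>This group is cyclic of order 4: both elements over \<open>a\<close> square to (e,
  -1).\<close>

lemma group_over_point: "group (L\<lparr>carrier := over {a}\<rparr>)"
  by (rule group_over) auto

text \<open>Quaternion group: the elements (p, 1), (q, 1), (r, 1) multiply like i, j, k, with (e,
  -1) in the role of -1.\<close>

lemma group_over_block:
  assumes "b \<in> B"
  shows "group (L\<lparr>carrier := over b\<rparr>)"
proof -
  \<comment> \<open>If the chosen cyclic order is the opposite one, swapping \<open>q\<close> and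
    \<open>r\<close> makes the labelling agree with it.\<close>
  obtain p q r where b: "b = {p, q, r}" and t: "(p, q, r) \<in> T"
  proof -
    obtain p q r where "b = {p, q, r}" using card_block[OF assms] by (auto simp: card_3_iff)
    then show ?thesis
      using that[of p q r] that[of p r q] orient_choice[of p q r] assms by (auto simp: insert_commute)
  qed
  have t': "(q, r, p) \<in> T" "(r, p, q) \<in> T" using t orient_rotate by blast+
  have blocks: "{p, q, r} \<in> B" "{q, r, p} \<in> B" "{r, p, q} \<in> B"
    "{p, r, q} \<in> B" "{q, p, r} \<in> B" "{r, q, p} \<in> B"
    using assms b by (simp_all add: insert_commute)
  have nt: "(p, r, q) \<notin> T" "(q, p, r) \<notin> T" "(r, q, p) \<notin> T"
    using t t' orient_choice[of p q r] orient_choice[of q r p] orient_choice[of r p q] blocks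
    by auto
  \<comment> \<open>The multiplication table of i, j, k: the third points of all six ordered pairs,
    and their signs.\<close>
  note table = blocks[THEN third_point_eq] block_distinct[OF blocks(1)]
    block_distinct[OF blocks(1), symmetric] t t' nt orientation_function_def
  show ?thesis
  proof (rule group_over)
    fix x y assume "x \<in> over b" "y \<in> over b"
    then show "x \<otimes>\<^bsub>L\<^esub> y \<in> over b"
      unfolding b by (elim SigmaE insertE imageE emptyE; simp add: table)
  next
    \<comment> \<open>Associativity of the extension splits into associativity of the Klein
      four-group below and the cocycle identity for the factor system; the signs of x, y, z factor
      out. This leaves 64 cases.\<close>
    have cocycle: "steiner_mult B (steiner_mult B u v) w = steiner_mult B u (steiner_mult B v w) \<and>
        factor_system4 B T (steiner_mult B u v) w * factor_system4 B T u v =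
        factor_system4 B T u (steiner_mult B v w) * factor_system4 B T v w"
      if "u \<in> {None, Some p, Some q, Some r}" "v \<in> {None, Some p, Some q, Some r}"
        "w \<in> {None, Some p, Some q, Some r}" for u v w
      using that by (elim insertE emptyE; simp add: table)
    fix x y z assume xyz: "x \<in> over b" "y \<in> over b" "z \<in> over b"
    obtain u \<xi> v \<eta> w \<zeta> where eq: "x = (u, \<xi>)" "y = (v, \<eta>)" "z = (w, \<zeta>)"
      by (cases x; cases y; cases z)
    have uvw: "u \<in> {None, Some p, Some q, Some r}" "v \<in> {None, Some p, Some q, Some r}"
      "w \<in> {None, Some p, Some q, Some r}"
      using xyz by (auto simp: b eq)
    have "factor_system4 B T (steiner_mult B u v) w * (factor_system4 B T u v * \<xi> * \<eta>) * \<zeta> =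
        (factor_system4 B T (steiner_mult B u v) w * factor_system4 B T u v) * (\<xi> * \<eta> * \<zeta>)"
      by (simp only: mult_ac)
    also have "\<dots> = (factor_system4 B T u (steiner_mult B v w) * factor_system4 B T v w) * (\<xi> * \<eta> * \<zeta>)"
      using cocycle[OF uvw] by simp
    also have "\<dots> = factor_system4 B T u (steiner_mult B v w) * \<xi> * (factor_system4 B T v w * \<eta> * \<zeta>)"
      by (simp only: mult_ac)
    finally show "(x \<otimes>\<^bsub>L\<^esub> y) \<otimes>\<^bsub>L\<^esub> z = x \<otimes>\<^bsub>L\<^esub> (y \<otimes>\<^bsub>L\<^esub> z)"
      using cocycle[OF uvw] by (simp add: eq)
  qed
qed

text \<open>Two distinct points span a block. The smaller cases give the cyclic group of order 4 and
  {1, -1}.\<close>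

lemma ex_group_over_pair:
  assumes "Q \<subseteq> P" "Q \<subseteq> {p, q}"
  shows "\<exists>R. Q \<subseteq> R \<and> R \<subseteq> P \<and> group (L\<lparr>carrier := over R\<rparr>)"
proof -
  consider "Q = {}" | a where "Q = {a}" | "Q = {p, q}" "p \<noteq> q" using assms(2) by blast
  then show ?thesis
  proof cases
    case 1
    have "group (L\<lparr>carrier := over {}\<rparr>)" by (rule group_over) auto
    then show ?thesis using 1 by blast
  next
    case 2
    then show ?thesis using assms(1) group_over_point by blast
  next
    case 3
    then obtain b where "b \<in> B" "Q \<subseteq> b" using unique_block[of p q] assms(1) by auto
    then show ?thesis using block_subset group_over_block by blast
  qed
qed

text \<open>\<open>set_option\<close> discards e, so the union is the set of points below the
  triple. Unless two points cover it, a, b, c are three distinct points, and associativity makes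
  them collinear.\<close>

lemma ex_group_over_assoc:
  assumes S: "set_option a \<union> set_option b \<union> set_option c \<subseteq> P"
    and assoc: "steiner_mult B a (steiner_mult B b c) = steiner_mult B (steiner_mult B a b) c"
  shows "\<exists>R. set_option a \<union> set_option b \<union> set_option c \<subseteq> R \<and> R \<subseteq> P \<and>
    group (L\<lparr>carrier := over R\<rparr>)"
proof (cases "\<exists>p q. set_option a \<union> set_option b \<union> set_option c \<subseteq> {p, q}")
  case True
  then show ?thesis using ex_group_over_pair[OF S] by blast
next
  case False
  then obtain p q r where pqr: "a = Some p" "b = Some q" "c = Some r"
    by (cases a; cases b; cases c) auto
  moreover have "distinct [p, q, r]" using False pqr by auto
  ultimately have "collinear_in B {p, q, r}"
    using steiner_mult_not_assoc[of p q r] S assoc by auto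
  then obtain d where "d \<in> B" "{p, q, r} \<subseteq> d" by (auto simp: collinear_in_def)
  then show ?thesis
    using block_subset group_over_block pqr by (intro exI[of _ d]) auto
qed

end

theorem theorem1:
  fixes P :: "'a set" and B :: "'a set set" and T :: "('a \<times> 'a \<times> 'a) set"
  assumes "oriented_hall_triple_system P B T"
  shows "satisfies_moufang_theorem (oriented_hall_loop4 P B T)"
proof -
  interpret oriented_hall_triple_system P B T by fact
  show ?thesis
    unfolding satisfies_moufang_theorem_def
  proof (intro ballI impI)
    fix x y z
    assume xyz: "x \<in> carrier L" "y \<in> carrier L" "z \<in> carrier L"
      and assoc: "x \<otimes>\<^bsub>L\<^esub> (y \<otimes>\<^bsub>L\<^esub> z) = (x \<otimes>\<^bsub>L\<^esub> y) \<otimes>\<^bsub>L\<^esub> z"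
    obtain R where R: "set_option (fst x) \<union> set_option (fst y) \<union> set_option (fst z) \<subseteq> R"
      "R \<subseteq> P" "group (L\<lparr>carrier := over R\<rparr>)"
    proof -
      have "set_option (fst x) \<union> set_option (fst y) \<union> set_option (fst z) \<subseteq> P"
        using xyz by auto
      \<comment> \<open>Projecting the hypothesis to first components gives associativity in the
        Steiner loop.\<close>
      moreover have "steiner_mult B (fst x) (steiner_mult B (fst y) (fst z)) =
          steiner_mult B (steiner_mult B (fst x) (fst y)) (fst z)"
        using assoc by (cases x; cases y; cases z) simp
      ultimately show ?thesis using ex_group_over_assoc[of "fst x" "fst y" "fst z"] that by metis
    qed
    show "group (L\<lparr>carrier := generated_subloop L {x, y, z}\<rparr>)"
    proof (rule group_generated_subloop)
      show "group (L\<lparr>carrier := over R\<rparr>)" by fact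
      show "over R \<subseteq> carrier L" using R(2) by auto
      show "{x, y, z} \<subseteq> over R" using R(1) xyz by auto
    qed (rule L_cube_inverse)
  qed
qed

end
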